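(* Let $\mathcal{F}=\{F_\mu:\mu\in U\}$ be a Type I location-shift family, let $a,b\in U$ be fixed and finite with $a<b$, and consider the bounded null $\Theta_0=(a,b)\cap U$. Set $$K_1(t,x)=\frac{t}{2\pi}\int_a^b dy\int_{[-1,1]}\frac{\cos\{ts(x-y)\}}{r_0(ts)}\,ds .$$ Then $$\psi_1(t,\mu):=\int K_1(t,x)\,dF_\mu(x)=\frac1\pi\int_{(\mu-b)t}^{(\mu-a)t}\frac{\sin y}{y}\,dy ,$$ and the pair $(\psi,K)$ given by $$K(t,x)=K_1(t,x)-2^{-1}\{K_{1,0}(t,x;a)+K_{1,0}(t,x;b)\},$$ $$\psi(t,\mu)=\psi_1(t,\mu)-2^{-1}\{\psi_{1,0}(t,\mu;a)+\psi_{1,0}(t,\mu;b)\}$$ is a pair of discriminant function and matching function for $\Theta_0=(a,b)\cap U$; that is, for every $\mu\in U$, $\lim_{t\to\infty}\psi(t,\mu)=1_{(a,b)}(\mu)$, and $\psi(t,\mu)=\int K(t,x)\,dF_\mu(x)$.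
   Context: $U\subseteq\mathbb{R}$ is a non-empty known set with non-empty interior and $\mathcal{F}=\{F_\mu:\mu\in U\}$ is a family of cumulative distribution functions (CDFs) on $\mathbb{R}$, each $F_\mu$ being uniquely determined by $\mu$ (its mean or median). $\mathcal{F}$ is a location-shift family if $z+\mu'$ has CDF $F_{\mu+\mu'}$ whenever $z$ has CDF $F_\mu$ and $\mu,\mu+\mu'\in U$. Let $\iota=\sqrt{-1}$, $\hat F_\mu(t)=\int e^{\iota tx}dF_\mu(x)$ and $r_\mu(t)=|\hat F_\mu(t)|$. $\mathcal{F}$ is a Type I location-shift family if it is a location-shift family for which $\hat F_0$ has no real zeros and $\hat F_0=r_0$ (so $0\in U$ is implicit). $\omega$ is an even, bounded probability density function on $[-1,1]$ of bounded variation. For $\mu'\in U$, $$K_{1,0}(t,x;\mu')=\int_{[-1,1]}\frac{\omega(s)\cos\{ts(x-\mu')\}}{r_{\mu'}(ts)}ds,\qquad \psi_{1,0}(t,\mu;\mu')=\int K_{1,0}(t,x;\mu')\,dF_\mu(x)$$ (the latter equals $\int_{[-1,1]}\omega(s)\cos\{ts(\mu-\mu')\}ds$). For a null set $\Theta_0$, a pair $(\psi,K)$ is a pair of discriminant function and matching function if, for every $\mu\in U$, $\lim_{t\to\infty}\psi(t,\mu)=1_{\Theta_0}(\mu)$, and $K:\mathbb{R}^2\to\mathbb{R}$ is a function of $(t,x)$ that does not depend on the parameter $\mu$ and satisfies $\psi(t,\mu)=\int K(t,x)\,dF_\mu(x)$ for all $\mu\in U$. An integral $\int dy\int g\,ds$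 denotes the iterated integral $\int(\int g\,ds)\,dy$. *)

theory Defs
  imports "HOL-Probability.Probability"
begin

section \<open>Parametrised families of distribution functions\<close>

definition is_cdf :: "(real \<Rightarrow> real) \<Rightarrow> bool" where
  "is_cdf G \<longleftrightarrow> mono G \<and> (\<forall>x. continuous (at_right x) G) \<and>
     (G \<longlongrightarrow> 0) at_bot \<and> (G \<longlongrightarrow> 1) at_top"

text \<open>
  Integration against \<open>dG\<close> is integration with respect to \<^const>\<open>interval_measure\<close> \<open>G\<close>,
  the Lebesgue--Stieltjes measure of \<open>G\<close>; for a CDF \<open>G\<close> it is the probability law with CDF \<open>G\<close>.
\<close>

definition is_mean :: "(real \<Rightarrow> real) \<Rightarrow> real \<Rightarrow> bool" where
  "is_mean G m \<longleftrightarrow> integrable (interval_measure G) (\<lambda>x. x) \<and>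
     (LINT x|interval_measure G. x) = m"

definition is_median :: "(real \<Rightarrow> real) \<Rightarrow> real \<Rightarrow> bool" where
  "is_median G m \<longleftrightarrow> measure (interval_measure G) {..m} \<ge> 1/2 \<and>
     measure (interval_measure G) {m..} \<ge> 1/2"

text \<open>
  That \<open>F \<mu>\<close> is uniquely determined by \<open>\<mu>\<close> is built into \<open>F\<close> being a function of \<open>\<mu>\<close>.
  Values of \<open>F\<close> outside \<open>U\<close> are irrelevant.
\<close>

definition cdf_family :: "real set \<Rightarrow> (real \<Rightarrow> real \<Rightarrow> real) \<Rightarrow> bool" where
  "cdf_family U F \<longleftrightarrow> U \<noteq> {} \<and> interior U \<noteq> {} \<and> (\<forall>\<mu>\<in>U. is_cdf (F \<mu>)) \<and>
     ((\<forall>\<mu>\<in>U. is_mean (F \<mu>) \<mu>) \<or> (\<forall>\<mu>\<in>U. is_median (F \<mu>) \<mu>))"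

text \<open>
  A random variable \<open>z\<close> has CDF \<open>F \<mu>\<close> iff its law is \<open>interval_measure (F \<mu>)\<close>, and then
  the law of \<open>z + \<mu>'\<close> is the image of that measure under translation by \<open>\<mu>'\<close>.
\<close>

definition location_shift_family :: "real set \<Rightarrow> (real \<Rightarrow> real \<Rightarrow> real) \<Rightarrow> bool" where
  "location_shift_family U F \<longleftrightarrow> cdf_family U F \<and>
     (\<forall>\<mu> \<mu>'. \<mu> \<in> U \<longrightarrow> \<mu> + \<mu>' \<in> U \<longrightarrow>
        cdf (distr (interval_measure (F \<mu>)) borel (\<lambda>z. z + \<mu>')) = F (\<mu> + \<mu>'))"

definition Fhat :: "(real \<Rightarrow> real \<Rightarrow> real) \<Rightarrow> real \<Rightarrow> real \<Rightarrow> complex" where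
  "Fhat F \<mu> t = char (interval_measure (F \<mu>)) t"

definition Fhat_modulus :: "(real \<Rightarrow> real \<Rightarrow> real) \<Rightarrow> real \<Rightarrow> real \<Rightarrow> real" where
  "Fhat_modulus F \<mu> t = cmod (Fhat F \<mu> t)"

definition type_I_location_shift_family :: "real set \<Rightarrow> (real \<Rightarrow> real \<Rightarrow> real) \<Rightarrow> bool" where
  "type_I_location_shift_family U F \<longleftrightarrow> location_shift_family U F \<and> 0 \<in> U \<and>
     (\<forall>t. Fhat F 0 t \<noteq> 0) \<and> (\<forall>t. Fhat F 0 t = complex_of_real (Fhat_modulus F 0 t))"

section \<open>The weight function\<close>

definition has_bounded_variation :: "real \<Rightarrow> real \<Rightarrow> (real \<Rightarrow> real) \<Rightarrow> bool" where
  "has_bounded_variation c d f \<longleftrightarrow>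
     (\<exists>B. \<forall>(n::nat) (p::nat \<Rightarrow> real).
        (\<forall>i\<le>n. p i \<in> {c..d}) \<longrightarrow> (\<forall>i<n. p i \<le> p (Suc i)) \<longrightarrow>
        (\<Sum>i<n. \<bar>f (p (Suc i)) - f (p i)\<bar>) \<le> B)"

definition admissible_weight :: "(real \<Rightarrow> real) \<Rightarrow> bool" where
  "admissible_weight \<omega> \<longleftrightarrow>
     (\<forall>s\<in>{-1..1}. 0 \<le> \<omega> s) \<and> set_integrable lborel {-1..1} \<omega> \<and>
     (LBINT s:{-1..1}. \<omega> s) = 1 \<and>
     (\<forall>s\<in>{-1..1}. \<omega> (- s) = \<omega> s) \<and> bounded (\<omega> ` {-1..1}) \<and>
     has_bounded_variation (-1) 1 \<omega>"

section \<open>Discriminant and matching functions\<close>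

text \<open>
  The Bochner integral of a non-integrable function is \<open>0\<close>, so the existence of
  \<open>\<integral> K(t,x) dF\<^sub>\<mu>(x)\<close> is stated separately.
\<close>

definition discriminant_matching_pair ::
  "real set \<Rightarrow> (real \<Rightarrow> real \<Rightarrow> real) \<Rightarrow> real set \<Rightarrow>
   (real \<Rightarrow> real \<Rightarrow> real) \<Rightarrow> (real \<Rightarrow> real \<Rightarrow> real) \<Rightarrow> bool" where
  "discriminant_matching_pair U F \<Theta>0 \<psi> K \<longleftrightarrow>
     (\<forall>\<mu>\<in>U. ((\<lambda>t. \<psi> t \<mu>) \<longlongrightarrow> indicator \<Theta>0 \<mu>) at_top) \<and>
     (\<forall>\<mu>\<in>U. \<forall>t. integrable (interval_measure (F \<mu>)) (K t) \<and>
        \<psi> t \<mu> = (LINT x|interval_measure (F \<mu>). K t x))"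

definition K10 ::
  "(real \<Rightarrow> real) \<Rightarrow> (real \<Rightarrow> real \<Rightarrow> real) \<Rightarrow> real \<Rightarrow> real \<Rightarrow> real \<Rightarrow> real" where
  "K10 \<omega> F \<mu>' t x =
     (LBINT s:{-1..1}. \<omega> s * cos (t * s * (x - \<mu>')) / Fhat_modulus F \<mu>' (t * s))"

definition psi10 ::
  "(real \<Rightarrow> real) \<Rightarrow> (real \<Rightarrow> real \<Rightarrow> real) \<Rightarrow> real \<Rightarrow> real \<Rightarrow> real \<Rightarrow> real" where
  "psi10 \<omega> F \<mu>' t \<mu> = (LINT x|interval_measure (F \<mu>). K10 \<omega> F \<mu>' t x)"

definition K1 :: "(real \<Rightarrow> real \<Rightarrow> real) \<Rightarrow> real \<Rightarrow> real \<Rightarrow> real \<Rightarrow> real \<Rightarrow> real" where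
  "K1 F a b t x = t / (2 * pi) *
     (LBINT y=a..b. (LBINT s:{-1..1}. cos (t * s * (x - y)) / Fhat_modulus F 0 (t * s)))"

definition psi1 :: "(real \<Rightarrow> real \<Rightarrow> real) \<Rightarrow> real \<Rightarrow> real \<Rightarrow> real \<Rightarrow> real \<Rightarrow> real" where
  "psi1 F a b t \<mu> = (LINT x|interval_measure (F \<mu>). K1 F a b t x)"

end

theory Submission
  imports Defs
begin

text \<open>
  Let \<open>r\<close> be the modulus of the characteristic function of \<open>F 0\<close>. A Type I family has
  characteristic functions \<open>e\<^sup>i\<^sup>u\<^sup>\<mu> r(u)\<close> with \<open>r\<close> real, continuous and positive, so that
  \<open>\<integral> cos(u(x - c)) dF\<^sub>\<mu>(x) = r(u) cos(u(\<mu> - c))\<close> for all real \<open>u\<close>, \<open>c\<close>. This identity,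
  with \<open>r\<close> continuous and positive, is all that the integral formulas need of the family; it is
  isolated in the locale \<open>cosine_transform\<close>. Dividing by \<open>r(ts)\<close>, which is bounded away from \<open>0\<close> for \<open>s\<close> in
  \<open>[-1,1]\<close>, and exchanging integrals (\<open>dominated_Fubini\<close>) gives, for every integrable weight \<open>w\<close>,
  \<open>\<integral> (\<integral> w(s) cos(ts(x - c)) / r(ts) ds) dF\<^sub>\<mu>(x) = \<integral> w(s) cos(ts(\<mu> - c)) ds\<close>
  (\<open>integral_kernel\<close>).

  With \<open>w = \<omega>\<close> and \<open>c\<close> an endpoint of the null, the right-hand side is \<open>1\<close> at \<open>\<mu> = c\<close>, and for
  \<open>\<mu> \<noteq> c\<close> it tends to \<open>0\<close> by the Riemann--Lebesgue lemma. The latter is proved here for all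
  integrable functions: the class of functions whose cosine transform vanishes at infinity contains
  the indicators of intervals, is closed under linear combinations and dominated limits, and hence,
  by a Dynkin class argument, contains all integrable functions.

  With \<open>w = 1\<close>, the right-hand side is \<open>2 sin(t(\<mu> - c)) / (t(\<mu> - c))\<close>, and integrating over \<open>c\<close>
  from \<open>a\<close> to \<open>b\<close> gives \<open>\<pi> \<psi>\<^sub>1(t,\<mu>) = Si(t(\<mu> - a)) - Si(t(\<mu> - b))\<close>, where \<open>Si\<close> is the sine integral.
  Since \<open>Si\<close> is odd with limit \<open>\<pi>/2\<close> at infinity, \<open>\<psi>\<^sub>1\<close> tends to \<open>1\<close> inside \<open>(a,b)\<close>, to \<open>0\<close>
  outside \<open>[a,b]\<close> and to \<open>1/2\<close> at the two endpoints, where the \<open>\<omega>\<close>-terms subtract \<open>1/2\<close>.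
\<close>

section \<open>The Riemann--Lebesgue lemma on the real line\<close>

text \<open>
  The cosine transform of \<open>f\<close> over the real line tends to \<open>0\<close> at infinity. Integrability of \<open>f\<close>
  is not part of the notion and is assumed separately where it is needed.
\<close>

definition cosine_decay :: "(real \<Rightarrow> real) \<Rightarrow> bool" where
  "cosine_decay f \<longleftrightarrow> ((\<lambda>u. LBINT s. f s * cos (u * s)) \<longlongrightarrow> 0) at_top"

lemma integrable_indicator_Int_Icc:
  fixes A :: "real set"
  assumes "A \<in> sets borel"
  shows "integrable lborel (indicat_real (A \<inter> {c..d}))"
proof (rule integrable_real_indicator)
  have "emeasure lborel (A \<inter> {c..d}) \<le> emeasure lborel {c..d}"
    by (intro emeasure_mono) auto
  also have "\<dots> < \<infinity>"
    by (simp add: emeasure_lborel_Icc_eq)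
  finally show "emeasure lborel (A \<inter> {c..d}) < \<infinity>" .
qed (use assms in simp)

lemma integrable_mult_cos:
  fixes f :: "real \<Rightarrow> real"
  assumes "integrable lborel f"
  shows "integrable lborel (\<lambda>s. f s * cos (u * s))"
proof (rule Bochner_Integration.integrable_bound[OF assms])
  show "(\<lambda>s. f s * cos (u * s)) \<in> borel_measurable lborel"
    using assms by measurable
  show "AE s in lborel. norm (f s * cos (u * s)) \<le> norm (f s)"
    by (auto simp: abs_mult mult_left_le)
qed

text \<open>
  The cosine transforms of \<open>s i\<close> and \<open>f\<close> differ by at most the \<open>L\<^sup>1\<close> distance of \<open>s i\<close> and \<open>f\<close>,
  uniformly in the frequency, so decay passes to the limit.
\<close>

lemma cosine_decay_dominated_limit:
  fixes f g :: "real \<Rightarrow> real"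
  assumes s_int: "\<And>i. integrable lborel (s i)" and s_decay: "\<And>i. cosine_decay (s i)"
    and lim: "\<And>x. (\<lambda>i. s i x) \<longlonglongrightarrow> f x"
    and bound: "\<And>i x. \<bar>s i x\<bar> \<le> g x" and g: "integrable lborel g"
  shows "cosine_decay f"
  unfolding cosine_decay_def
proof (rule tendstoI)
  fix e :: real assume "0 < e"
  have s_meas: "\<And>i. s i \<in> borel_measurable lborel"
    using s_int by auto
  have f_meas: "f \<in> borel_measurable lborel"
    using s_meas lim by (rule borel_measurable_LIMSEQ_real[rotated])
  have f_int: "integrable lborel f"
    by (rule integrable_dominated_convergence[where s = s, OF f_meas s_meas g]) (use lim bound in auto)
  have "(\<lambda>i. LBINT x. \<bar>s i x - f x\<bar>) \<longlonglongrightarrow> (LBINT (x::real). 0)"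
  proof (rule integral_dominated_convergence[where w = "\<lambda>x. g x + \<bar>f x\<bar>"])
    show "AE x in lborel. (\<lambda>i. \<bar>s i x - f x\<bar>) \<longlonglongrightarrow> 0"
      using tendsto_rabs_zero[OF LIM_zero[OF lim]] by simp
    show "AE x in lborel. norm \<bar>s i x - f x\<bar> \<le> g x + \<bar>f x\<bar>" for i
      using bound[of i] by (intro AE_I2) (smt (verit) real_norm_def)
  qed (use s_meas f_meas g f_int in auto)
  then have "eventually (\<lambda>i. \<bar>LBINT x. \<bar>s i x - f x\<bar>\<bar> < e / 2) sequentially"
    using \<open>0 < e\<close> by (auto dest!: tendstoD[where e = "e / 2"])
  then obtain i where i: "(LBINT x. \<bar>s i x - f x\<bar>) < e / 2"
    by (auto simp: eventually_sequentially)
  have "eventually (\<lambda>u. \<bar>LBINT x. s i x * cos (u * x)\<bar> < e / 2) at_top"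
    using s_decay[of i] \<open>0 < e\<close> unfolding cosine_decay_def
    by (auto dest!: tendstoD[where e = "e / 2"])
  then show "eventually (\<lambda>u. dist (LBINT x. f x * cos (u * x)) 0 < e) at_top"
  proof eventually_elim
    case (elim u)
    have diff: "integrable lborel (\<lambda>x. s i x - f x)"
      using s_int f_int by auto
    have "\<bar>LBINT x. (s i x - f x) * cos (u * x)\<bar> \<le> (LBINT x. \<bar>(s i x - f x) * cos (u * x)\<bar>)"
      by (rule integral_abs_bound)
    also have "\<dots> \<le> (LBINT x. \<bar>s i x - f x\<bar>)"
      by (intro integral_mono integrable_abs integrable_mult_cos diff)
         (auto simp: abs_mult mult_left_le)
    finally have "\<bar>LBINT x. (s i x - f x) * cos (u * x)\<bar> < e / 2"
      using i by simp
    moreover have "(LBINT x. (s i x - f x) * cos (u * x)) =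
        (LBINT x. s i x * cos (u * x)) - (LBINT x. f x * cos (u * x))"
      using integrable_mult_cos[OF s_int] integrable_mult_cos[OF f_int]
      by (simp add: left_diff_distrib)
    ultimately show ?case
      using elim unfolding dist_real_def by linarith
  qed
qed

lemma cosine_decay_add:
  assumes "integrable lborel f" "integrable lborel g" "cosine_decay f" "cosine_decay g"
  shows "cosine_decay (\<lambda>x. f x + g x)"
  using tendsto_add[OF assms(3,4)[unfolded cosine_decay_def]]
    integrable_mult_cos[OF assms(1)] integrable_mult_cos[OF assms(2)]
  by (simp add: cosine_decay_def distrib_right)

lemma cosine_decay_scale:
  assumes "cosine_decay f"
  shows "cosine_decay (\<lambda>x. f x * c)"
  using tendsto_mult_left_zero[OF assms[unfolded cosine_decay_def], of c]
  by (simp add: cosine_decay_def mult_ac flip: integral_mult_left_zero)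

lemma cosine_decay_interval: "cosine_decay (indicator {c..d})"
proof (cases "c \<le> d")
  case True
  have "((\<lambda>u. (sin (u * d) - sin (u * c)) / u) \<longlongrightarrow> 0) at_top"
  proof (rule Lim_null_comparison)
    show "((\<lambda>u::real. 2 / u) \<longlongrightarrow> 0) at_top"
      by real_asymp
    show "\<forall>\<^sub>F u in at_top. norm ((sin (u * d) - sin (u * c)) / u) \<le> 2 / u"
      using eventually_gt_at_top[of 0]
    proof eventually_elim
      case (elim u)
      have "\<bar>sin (u * d) - sin (u * c)\<bar> \<le> 2"
        using abs_sin_le_one[of "u * d"] abs_sin_le_one[of "u * c"] by linarith
      then show ?case
        using elim by (simp add: divide_right_mono)
    qed
  qed
  moreover have "\<forall>\<^sub>F u in at_top. (sin (u * d) - sin (u * c)) / u =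
      (LBINT s. indicator {c..d} s * cos (u * s))"
    using eventually_gt_at_top[of 0]
  proof eventually_elim
    case (elim u)
    have "(LBINT s. indicator {c..d} s *\<^sub>R cos (u * s)) = sin (u * d) / u - sin (u * c) / u"
      using True elim
      by (intro integral_FTC_atLeastAtMost)
         (auto intro!: continuous_intros derivative_eq_intros
           simp: has_real_derivative_iff_has_vector_derivative[symmetric])
    then show ?case
      by (simp add: diff_divide_distrib)
  qed
  ultimately show ?thesis
    unfolding cosine_decay_def by (rule Lim_transform_eventually)
qed (simp add: cosine_decay_def)

text \<open>
  The Borel sets \<open>A\<close> with this property form a Dynkin class that contains the intervals.
  Intersecting with a bounded interval keeps complements integrable.
\<close>

lemma cosine_decay_bounded_set:
  assumes "A \<in> sets borel"
  shows "cosine_decay (indicator (A \<inter> {c..d}))"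
  using assms
proof (induction rule: borel_set_induct)
  case empty
  show ?case by (simp add: cosine_decay_def)
next
  case (interval p q)
  have "{p..q} \<inter> {c..d} = {max p c..min q d}" by auto
  then show ?case by (simp add: cosine_decay_interval)
next
  case (compl A)
  have int: "integrable lborel (indicat_real (A \<inter> {c..d}))" "integrable lborel (indicat_real {c..d})"
    using integrable_indicator_Int_Icc[OF compl(1)] integrable_indicator_Int_Icc[of UNIV] by auto
  have "cosine_decay (\<lambda>x. indicator {c..d} x + indicator (A \<inter> {c..d}) x * (-1))"
    using compl int by (intro cosine_decay_add cosine_decay_scale cosine_decay_interval) auto
  also have "(\<lambda>x. indicator {c..d} x + indicator (A \<inter> {c..d}) x * (-1)) =
      indicat_real (- A \<inter> {c..d})"
    by (auto simp: indicator_def)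
  finally show ?case .
next
  case (union A)
  note int = integrable_indicator_Int_Icc
  have part_eq: "indicat_real ((\<Union>i<n. A i) \<inter> {c..d}) = (\<lambda>x. \<Sum>i<n. indicator (A i \<inter> {c..d}) x)" for n
  proof
    fix x
    have "(\<Union>i<n. A i) \<inter> {c..d} = (\<Union>i<n. A i \<inter> {c..d})" by auto
    then show "indicat_real ((\<Union>i<n. A i) \<inter> {c..d}) x = (\<Sum>i<n. indicator (A i \<inter> {c..d}) x)"
      using union(1)
      by (simp only:) (subst indicator_UN_disjoint, auto simp: disjoint_family_on_def)
  qed
  have decay: "cosine_decay (indicat_real ((\<Union>i<n. A i) \<inter> {c..d}))" for n
  proof (induction n)
    case 0
    show ?case by (simp add: cosine_decay_def)
  next
    case (Suc n)
    have "cosine_decay (\<lambda>x. indicat_real ((\<Union>i<n. A i) \<inter> {c..d}) x + indicator (A n \<inter> {c..d}) x)"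
      using Suc union by (intro cosine_decay_add int) auto
    then show ?case
      unfolding part_eq by simp
  qed
  show ?case
  proof (rule cosine_decay_dominated_limit)
    show "(\<lambda>n. indicat_real ((\<Union>i<n. A i) \<inter> {c..d}) x) \<longlonglongrightarrow> indicator ((\<Union>i. A i) \<inter> {c..d}) x" for x
    proof -
      have "(\<lambda>n. indicat_real (\<Union>i<n. A i) x) \<longlonglongrightarrow> indicator (\<Union>i. A i) x"
        by (rule LIMSEQ_indicator_UN)
      then show ?thesis
        by (auto simp: indicator_inter_arith intro!: tendsto_intros)
    qed
    show "\<bar>indicat_real ((\<Union>i<n. A i) \<inter> {c..d}) x\<bar> \<le> indicator {c..d} x" for n x
      by (auto simp: indicator_def)
    show "integrable lborel (indicat_real ((\<Union>i<n. A i) \<inter> {c..d}))" for n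
      using union(2) by (intro int) auto
  qed (use decay int[of UNIV] in auto)
qed

lemma Riemann_Lebesgue_cos:
  fixes f :: "real \<Rightarrow> real"
  assumes "integrable lborel f"
  shows "((\<lambda>u. LBINT s. f s * cos (u * s)) \<longlongrightarrow> 0) at_top"
proof -
  have "cosine_decay f"
    using assms
  proof (induction rule: integrable_induct)
    case (base A c)
    have A: "A \<in> sets borel" using base by simp
    have "cosine_decay (indicator A)"
    proof (rule cosine_decay_dominated_limit)
      show "(\<lambda>n. indicat_real (A \<inter> {- real n..real n}) x) \<longlonglongrightarrow> indicator A x" for x
      proof (rule tendsto_eventually)
        obtain N where N: "\<bar>x\<bar> \<le> real N" using real_arch_simple by blast
        show "\<forall>\<^sub>F n in sequentially. indicat_real (A \<inter> {- real n..real n}) x = indicator A x"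
          using eventually_ge_at_top[of N] by eventually_elim (use N in \<open>auto simp: indicator_def\<close>)
      qed
      show "integrable lborel (indicat_real A)"
        using base by (intro integrable_real_indicator) auto
      show "integrable lborel (indicat_real (A \<inter> {- real n..real n}))" for n
        using A by (rule integrable_indicator_Int_Icc)
      show "\<bar>indicat_real (A \<inter> {- real n..real n}) x\<bar> \<le> indicator A x" for n x
        by (auto simp: indicator_def)
    qed (rule cosine_decay_bounded_set[OF A])
    then show ?case by (simp add: cosine_decay_scale)
  next
    case (add f g)
    then show ?case by (intro cosine_decay_add)
  next
    case (lim f s)
    show ?case
      by (rule cosine_decay_dominated_limit[where s = s and g = "\<lambda>x. 2 * \<bar>f x\<bar>"]) (use lim in auto)
  qed
  then show ?thesis by (simp add: cosine_decay_def)
qed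

lemma set_Riemann_Lebesgue_cos:
  fixes w :: "real \<Rightarrow> real"
  assumes w: "set_integrable lborel A w" and "c \<noteq> 0"
  shows "((\<lambda>t. LBINT s:A. w s * cos (t * s * c)) \<longlongrightarrow> 0) at_top"
proof -
  have "((\<lambda>u. LBINT s. (indicator A s * w s) * cos (u * s)) \<longlongrightarrow> 0) at_top"
    using w by (intro Riemann_Lebesgue_cos) (simp add: set_integrable_def)
  moreover have "filterlim (\<lambda>t. \<bar>c\<bar> * t) at_top at_top"
    using \<open>c \<noteq> 0\<close> by (intro filterlim_tendsto_pos_mult_at_top[OF tendsto_const] filterlim_ident) auto
  ultimately have "((\<lambda>t. LBINT s. (indicator A s * w s) * cos (\<bar>c\<bar> * t * s)) \<longlongrightarrow> 0) at_top"
    by (rule filterlim_compose)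
  moreover have "cos (\<bar>c\<bar> * t * s) = cos (t * s * c)" for t s
    by (cases "c \<ge> 0") (auto simp: mult_ac)
  ultimately show ?thesis
    by (simp add: set_lebesgue_integral_def mult_ac)
qed

section \<open>Inversion of the location-shift transform\<close>

text \<open>
  Since \<open>M\<close> is finite, a bound that is integrable in \<open>s\<close> and uniform in \<open>x\<close> suffices.
\<close>

lemma dominated_Fubini:
  fixes f :: "real \<Rightarrow> real \<Rightarrow> real"
  assumes "real_distribution M"
    and f: "case_prod f \<in> borel_measurable (borel \<Otimes>\<^sub>M borel)"
    and bound: "\<And>x s. \<bar>f x s\<bar> \<le> g s" and g: "integrable lborel g"
  shows "integrable M (\<lambda>x. LBINT s. f x s)"
    and "(LINT x|M. (LBINT s. f x s)) = (LBINT s. (LINT x|M. f x s))"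
proof -
  interpret real_distribution M by fact
  interpret P: pair_sigma_finite M lborel ..
  have meas[measurable]: "case_prod f \<in> borel_measurable (M \<Otimes>\<^sub>M lborel)"
    using f by simp
  have sec: "integrable lborel (f x)" for x
  proof (rule Bochner_Integration.integrable_bound[OF g])
    show "f x \<in> borel_measurable lborel"
      using measurable_Pair2[OF f, of x] by simp
    show "AE s in lborel. norm (f x s) \<le> norm (g s)"
      using order_trans[OF bound abs_ge_self] by simp
  qed
  have int: "integrable (M \<Otimes>\<^sub>M lborel) (case_prod f)"
  proof (rule P.Fubini_integrable)
    show "integrable M (\<lambda>x. LBINT s. norm (case_prod f (x, s)))"
    proof (rule integrable_const_bound[where B = "LBINT s. g s"])
      have "(LBINT s. \<bar>f x s\<bar>) \<le> (LBINT s. g s)" for x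
        using sec g bound by (intro integral_mono) auto
      then show "AE x in M. norm (LBINT s. norm (case_prod f (x, s))) \<le> (LBINT s. g s)"
        by simp
    qed measurable
  qed (use sec in auto)
  show "integrable M (\<lambda>x. LBINT s. f x s)"
    using P.integrable_fst'[OF int] by simp
  show "(LINT x|M. (LBINT s. f x s)) = (LBINT s. (LINT x|M. f x s))"
    using P.Fubini_integral[OF int] by simp
qed

text \<open>
  The factor \<open>1 / r\<close> undoes the multiplication by \<open>r\<close> that integration against the law causes.
  As a function of \<open>u = x - c\<close> this is the common form of both matching functions: the weight
  \<open>w\<close> is \<open>\<omega>\<close> for \<^const>\<open>K10\<close>, and constantly \<open>1\<close> for the integrand of \<^const>\<open>K1\<close>.
\<close>

definition deconvolution_kernel ::
  "(real \<Rightarrow> real) \<Rightarrow> (real \<Rightarrow> real) \<Rightarrow> real \<Rightarrow> real \<Rightarrow> real" where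
  "deconvolution_kernel w r t u = (LBINT s:{-1..1}. w s * cos (t * s * u) / r (t * s))"

text \<open>
  A law \<open>M\<close> that is the translate by \<open>m\<close> of a law with real, positive characteristic function \<open>r\<close>,
  expressed through the cosine integrals of \<open>M\<close>.
\<close>

locale cosine_transform = real_distribution M for M :: "real measure" +
  fixes r :: "real \<Rightarrow> real" and m :: real
  assumes r_cont: "continuous_on UNIV r" and r_pos: "\<And>u. r u > 0"
    and transform: "\<And>u c. (LINT x|M. cos (u * (x - c))) = r u * cos (u * (m - c))"
begin

text \<open>
  The bound \<open>g\<close> depends on \<open>t\<close> but not on \<open>u\<close>: it is \<open>\<bar>w\<bar>\<close> divided by the minimum of \<open>r(ts)\<close>
  over \<open>s\<close> in \<open>[-1,1]\<close>.
\<close>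

lemma weight_dominates:
  assumes w: "set_integrable lborel {-1..1} w"
  obtains g where "integrable lborel g"
    "\<And>u s. \<bar>indicator {-1..1} s * (w s * cos (t * s * u) / r (t * s))\<bar> \<le> g s"
    "(\<lambda>(u, s). indicator {-1..1} s * (w s * cos (t * s * u) / r (t * s)))
       \<in> borel_measurable (borel \<Otimes>\<^sub>M borel)"
proof -
  let ?w = "\<lambda>s. indicator {-1..1} s * w s"
  have w_int: "integrable lborel ?w"
    using w by (simp add: set_integrable_def)
  then have [measurable]: "?w \<in> borel_measurable borel"
    by auto
  have [measurable]: "r \<in> borel_measurable borel"
    using r_cont by (rule borel_measurable_continuous_onI)
  have "\<exists>x\<in>{-1..1}. \<forall>y\<in>{-1..1}. r (t * x) \<le> r (t * y)"
    by (intro continuous_attains_inf continuous_on_compose2[OF r_cont] continuous_intros) auto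
  then obtain x0 where x0: "\<And>y. y \<in> {-1..1} \<Longrightarrow> r (t * x0) \<le> r (t * y)"
    by blast
  show thesis
  proof
    show "integrable lborel (\<lambda>s. \<bar>?w s\<bar> / r (t * x0))"
      using w_int by auto
    show "\<bar>indicator {-1..1} s * (w s * cos (t * s * u) / r (t * s))\<bar> \<le> \<bar>?w s\<bar> / r (t * x0)" for u s
    proof (cases "s \<in> {-1..1}")
      case True
      have "\<bar>w s * cos (t * s * u) / r (t * s)\<bar> = \<bar>w s\<bar> * \<bar>cos (t * s * u)\<bar> / r (t * s)"
        using r_pos[of "t * s"] by (simp add: abs_mult)
      also have "\<dots> \<le> \<bar>w s\<bar> / r (t * s)"
        using r_pos[of "t * s"] by (intro divide_right_mono) (auto simp: mult_left_le)
      also have "\<dots> \<le> \<bar>w s\<bar> / r (t * x0)"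
        using r_pos[of "t * x0"] x0[OF True] by (intro divide_left_mono) (auto simp: r_pos)
      finally show ?thesis using True by simp
    qed simp
    have "(\<lambda>(u, s). ?w s * cos (t * s * u) / r (t * s)) \<in> borel_measurable (borel \<Otimes>\<^sub>M borel)"
      by measurable
    then show "(\<lambda>(u, s). indicator {-1..1} s * (w s * cos (t * s * u) / r (t * s)))
       \<in> borel_measurable (borel \<Otimes>\<^sub>M borel)"
      by (simp add: mult_ac)
  qed
qed

lemma kernel_measurable_bounded:
  assumes w: "set_integrable lborel {-1..1} w"
  shows "deconvolution_kernel w r t \<in> borel_measurable borel"
    and "\<exists>B. \<forall>u. \<bar>deconvolution_kernel w r t u\<bar> \<le> B"
proof -
  obtain g where g: "integrable lborel g"
    "\<And>u s. \<bar>indicator {-1..1} s * (w s * cos (t * s * u) / r (t * s))\<bar> \<le> g s"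
    and meas: "(\<lambda>(u, s). indicator {-1..1} s * (w s * cos (t * s * u) / r (t * s)))
       \<in> borel_measurable (borel \<Otimes>\<^sub>M borel)"
    using weight_dominates[OF w] by blast
  have "(\<lambda>u. LBINT s. indicator {-1..1} s * (w s * cos (t * s * u) / r (t * s)))
      \<in> borel_measurable borel"
    using meas by (intro lborel.borel_measurable_lebesgue_integral) simp
  then show "deconvolution_kernel w r t \<in> borel_measurable borel"
    by (simp add: deconvolution_kernel_def[abs_def] set_lebesgue_integral_def)
  have "\<bar>deconvolution_kernel w r t u\<bar> \<le> (LBINT s. g s)" for u
  proof -
    have m: "(\<lambda>s. indicator {-1..1} s * (w s * cos (t * s * u) / r (t * s))) \<in> borel_measurable borel"
      using measurable_Pair2[OF meas, of u] by simp
    have "integrable lborel (\<lambda>s. indicator {-1..1} s * (w s * cos (t * s * u) / r (t * s)))"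
      by (rule Bochner_Integration.integrable_bound[OF g(1)])
         (use m g(2) in \<open>auto intro!: AE_I2 intro: order_trans[OF _ abs_ge_self]\<close>)
    then have "norm (LBINT s. indicator {-1..1} s * (w s * cos (t * s * u) / r (t * s))) \<le> (LBINT s. g s)"
      using g by (intro Bochner_Integration.integral_norm_bound_integral) auto
    then show ?thesis
      by (simp add: deconvolution_kernel_def set_lebesgue_integral_def)
  qed
  then show "\<exists>B. \<forall>u. \<bar>deconvolution_kernel w r t u\<bar> \<le> B"
    by blast
qed

text \<open>
  Under the \<open>s\<close>-integral, averaging over \<open>x\<close> produces the factor \<open>r(ts)\<close>, which cancels.
\<close>

lemma integral_kernel:
  assumes w: "set_integrable lborel {-1..1} w"
  shows "integrable M (\<lambda>x. deconvolution_kernel w r t (x - c))"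
    and "(LINT x|M. deconvolution_kernel w r t (x - c)) =
      (LBINT s:{-1..1}. w s * cos (t * s * (m - c)))"
proof -
  let ?f = "\<lambda>u s. indicator {-1..1} s * (w s * cos (t * s * u) / r (t * s))"
  obtain g where g: "integrable lborel g" "\<And>u s. \<bar>?f u s\<bar> \<le> g s"
    and meas[measurable]: "case_prod ?f \<in> borel_measurable (borel \<Otimes>\<^sub>M borel)"
    using weight_dominates[OF w] by blast
  have "(\<lambda>p. case_prod ?f (fst p - c, snd p)) \<in> borel_measurable (borel \<Otimes>\<^sub>M borel)"
    by (rule measurable_compose[OF _ meas]) measurable
  then have shift: "(\<lambda>(x, s). ?f (x - c) s) \<in> borel_measurable (borel \<Otimes>\<^sub>M borel)"
    by (simp add: case_prod_beta')
  note fub = dominated_Fubini[OF real_distribution_axioms shift g(2) g(1)]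
  show "integrable M (\<lambda>x. deconvolution_kernel w r t (x - c))"
    using fub(1) by (simp add: deconvolution_kernel_def set_lebesgue_integral_def)
  have "(LINT x|M. ?f (x - c) s) = indicator {-1..1} s * (w s * cos (t * s * (m - c)))" for s
  proof -
    have "(LINT x|M. ?f (x - c) s) =
        (LINT x|M. (indicator {-1..1} s * w s / r (t * s)) * cos (t * s * (x - c)))"
      by (simp add: mult_ac)
    also have "\<dots> = indicator {-1..1} s * w s / r (t * s) * (r (t * s) * cos (t * s * (m - c)))"
      by (simp only: integral_mult_right_zero transform)
    finally show ?thesis
      using r_pos[of "t * s"] by simp
  qed
  then show "(LINT x|M. deconvolution_kernel w r t (x - c)) =
      (LBINT s:{-1..1}. w s * cos (t * s * (m - c)))"
    using fub(2) by (simp add: deconvolution_kernel_def set_lebesgue_integral_def)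
qed

lemma integral_kernel_interval:
  assumes w: "set_integrable lborel {-1..1} w"
  shows "integrable M (\<lambda>x. LBINT y:{a..b}. deconvolution_kernel w r t (x - y))"
    and "(LINT x|M. (LBINT y:{a..b}. deconvolution_kernel w r t (x - y))) =
      (LBINT y:{a..b}. (LBINT s:{-1..1}. w s * cos (t * s * (m - y))))"
proof -
  note [measurable] = kernel_measurable_bounded(1)[OF w]
  obtain B where B: "\<And>u. \<bar>deconvolution_kernel w r t u\<bar> \<le> B"
    using kernel_measurable_bounded(2)[OF w] by blast
  have g: "integrable lborel (\<lambda>y. indicator {a..b} y * B)"
    by (intro integrable_mult_left integrable_real_indicator) (auto simp: emeasure_lborel_Icc_eq)
  have meas: "(\<lambda>(x, y). indicator {a..b} y * deconvolution_kernel w r t (x - y))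
      \<in> borel_measurable (borel \<Otimes>\<^sub>M borel)"
    by measurable
  have "\<bar>indicator {a..b} y * deconvolution_kernel w r t (x - y)\<bar> \<le> indicator {a..b} y * B" for x y
    using B by (simp add: indicator_def)
  note fub = dominated_Fubini[OF real_distribution_axioms meas this g]
  show "integrable M (\<lambda>x. LBINT y:{a..b}. deconvolution_kernel w r t (x - y))"
    using fub(1) by (simp add: set_lebesgue_integral_def)
  show "(LINT x|M. (LBINT y:{a..b}. deconvolution_kernel w r t (x - y))) =
      (LBINT y:{a..b}. (LBINT s:{-1..1}. w s * cos (t * s * (m - y))))"
    using fub(2) by (simp add: set_lebesgue_integral_def integral_kernel(2)[OF w, unfolded set_lebesgue_integral_def])
qed

end

section \<open>The sine integral\<close>

text \<open>
  The integrand has the value \<open>0\<close>, not \<open>1\<close>, at \<open>0\<close> because \<open>0 / 0 = 0\<close>; this null set is what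
  separates it from the continuous function \<open>sinc\<close>. The bounds \<open>p\<close>, \<open>q\<close> may come in either order.
\<close>

lemma LBINT_sinc_eq_Si_diff: "(LBINT y=ereal p..ereal q. sin y / y) = Si q - Si p"
proof -
  have "(LBINT y=ereal p..ereal q. sin y / y) = (LBINT y=ereal p..ereal q. sinc y)"
    by (rule interval_integral_discrete_difference[of "{0}"]) auto
  also have "\<dots> = Si q - Si p"
    by (intro interval_integral_FTC_finite continuous_on_sinc continuous_on_id
        DERIV_Si[unfolded has_real_derivative_iff_has_vector_derivative,
          THEN has_vector_derivative_at_within])
  finally show ?thesis .
qed

lemma Si_zero: "Si 0 = 0"
  using Si_neg[of 0] by simp

lemma Si_at_bot: "(Si \<longlongrightarrow> - (pi / 2)) at_bot"
proof -
  have "((\<lambda>x. - Si x) \<longlongrightarrow> - (pi / 2)) at_top"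
    by (intro tendsto_minus Si_at_top)
  then have "((\<lambda>x. Si (- x)) \<longlongrightarrow> - (pi / 2)) at_top"
    by (rule Lim_transform_eventually)
       (auto simp: Si_neg intro: eventually_mono[OF eventually_ge_at_top[of 0]])
  then show ?thesis
    by (simp add: filterlim_at_bot_mirror)
qed

lemma tendsto_Si_scaled: "((\<lambda>t. Si (c * t)) \<longlongrightarrow> sgn c * (pi / 2)) at_top"
proof (cases c "0::real" rule: linorder_cases)
  case less
  have "filterlim (\<lambda>t. c * t) at_bot at_top"
    by (intro filterlim_tendsto_neg_mult_at_bot[OF tendsto_const less] filterlim_ident)
  from filterlim_compose[OF Si_at_bot this] show ?thesis
    using less by simp
next
  case greater
  have "filterlim (\<lambda>t. c * t) at_top at_top"
    by (intro filterlim_tendsto_pos_mult_at_top[OF tendsto_const greater] filterlim_ident)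
  from filterlim_compose[OF Si_at_top this] show ?thesis
    using greater by simp
qed (simp add: Si_zero)

lemma LBINT_cos_eq_sinc: "(LBINT s:{-1..1}. cos (s * u)) = 2 * sinc u"
proof (cases "u = 0")
  case False
  have "(LBINT s. indicator {-1..1} s *\<^sub>R cos (s * u)) = sin (1 * u) / u - sin (- 1 * u) / u"
    using False
    by (intro integral_FTC_atLeastAtMost)
       (auto intro!: continuous_intros derivative_eq_intros
         simp: has_real_derivative_iff_has_vector_derivative[symmetric])
  then show ?thesis
    using False by (simp add: set_lebesgue_integral_def)
qed (simp add: set_lebesgue_integral_def)

text \<open>
  The integrand \<open>t sinc((m - y)t)\<close> is the derivative of \<open>- Si((m - y)t)\<close> in \<open>y\<close>, whatever the sign
  of \<open>t\<close>.
\<close>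

lemma LBINT_interval_cos_eq_Si_diff:
  assumes "a \<le> b"
  shows "t / 2 * (LBINT y:{a..b}. (LBINT s:{-1..1}. cos (t * s * (m - y)))) =
    Si ((m - a) * t) - Si ((m - b) * t)"
proof -
  define k where "k y = sinc ((m - y) * t)" for y
  have deriv: "((\<lambda>y. - Si ((m - y) * t)) has_real_derivative t * k y) (at y within S)" for y S
  proof -
    have "((\<lambda>y. (m - y) * t) has_real_derivative - t) (at y within S)"
      by (auto intro!: derivative_eq_intros)
    from DERIV_minus[OF DERIV_chain2[OF DERIV_Si this]]
    have "((\<lambda>y. - Si ((m - y) * t)) has_real_derivative - (k y * - t)) (at y within S)"
      by (simp only: k_def)
    then show ?thesis
      by (simp add: mult.commute)
  qed
  have k_cont: "continuous_on S k" for S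
    unfolding k_def[abs_def] by (intro continuous_intros)
  have k_int: "(LBINT y. indicator {a..b} y *\<^sub>R (t * k y)) =
      - Si ((m - b) * t) - - Si ((m - a) * t)"
    by (intro integral_FTC_atLeastAtMost assms continuous_intros k_cont
        deriv[unfolded has_real_derivative_iff_has_vector_derivative])
  have inner: "(LBINT s:{-1..1}. cos (t * s * (m - y))) = 2 * k y" for y
  proof -
    have "(LBINT s:{-1..1}. cos (t * s * (m - y))) = (LBINT s:{-1..1}. cos (s * ((m - y) * t)))"
      by (simp add: mult_ac)
    then show ?thesis
      by (simp only: LBINT_cos_eq_sinc k_def)
  qed
  have "t / 2 * (LBINT y:{a..b}. (LBINT s:{-1..1}. cos (t * s * (m - y)))) =
      (LBINT y. indicator {a..b} y *\<^sub>R (t * k y))"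
    unfolding inner by (simp add: set_lebesgue_integral_def mult.left_commute)
  then show ?thesis
    unfolding k_int by simp
qed

section \<open>Type I location-shift families\<close>

lemma type_I_law:
  assumes "type_I_location_shift_family U F" and "\<mu> \<in> U"
  shows "real_distribution (interval_measure (F \<mu>))"
    and "interval_measure (F \<mu>) = distr (interval_measure (F 0)) borel (\<lambda>z. z + \<mu>)"
proof -
  have fam: "location_shift_family U F" "0 \<in> U" and cdf: "\<And>\<nu>. \<nu> \<in> U \<Longrightarrow> is_cdf (F \<nu>)"
    using assms(1) by (auto simp: type_I_location_shift_family_def location_shift_family_def cdf_family_def)
  have rd: "real_distribution (interval_measure (F \<nu>))" "cdf (interval_measure (F \<nu>)) = F \<nu>"
    if "\<nu> \<in> U" for \<nu>
    using cdf[OF that]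
    by (auto simp: is_cdf_def mono_def intro!: real_distribution_interval_measure cdf_interval_measure)
  show "real_distribution (interval_measure (F \<mu>))"
    by (rule rd) fact
  interpret D: real_distribution "interval_measure (F 0)"
    using rd fam by auto
  have "real_distribution (distr (interval_measure (F 0)) borel (\<lambda>z. z + \<mu>))"
    by (intro D.real_distribution_distr) auto
  moreover have "cdf (distr (interval_measure (F 0)) borel (\<lambda>z. z + \<mu>)) = F \<mu>"
    using fam \<open>\<mu> \<in> U\<close> unfolding location_shift_family_def by (metis add_0)
  ultimately show "interval_measure (F \<mu>) = distr (interval_measure (F 0)) borel (\<lambda>z. z + \<mu>)"
    using rd[OF \<open>\<mu> \<in> U\<close>] by (intro cdf_unique) auto
qed

lemma type_I_Fhat:
  assumes "type_I_location_shift_family U F" and "\<mu> \<in> U"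
  shows "Fhat F \<mu> t = iexp (t * \<mu>) * Fhat F 0 t"
proof -
  have "Fhat F \<mu> t = (CLINT z|interval_measure (F 0). iexp (t * (z + \<mu>)))"
    unfolding Fhat_def char_def type_I_law(2)[OF assms]
    by (subst integral_distr) auto
  also have "\<dots> = (CLINT z|interval_measure (F 0). iexp (t * \<mu>) * iexp (t * z))"
    by (simp add: distrib_left exp_add mult_ac)
  also have "\<dots> = iexp (t * \<mu>) * Fhat F 0 t"
    by (simp add: Fhat_def char_def)
  finally show ?thesis .
qed

lemma type_I_modulus:
  assumes "type_I_location_shift_family U F" and "\<mu> \<in> U"
  shows "Fhat_modulus F \<mu> = Fhat_modulus F 0"
  by (auto simp: Fhat_modulus_def type_I_Fhat[OF assms] norm_mult)

lemma type_I_cosine_transform: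
  assumes "type_I_location_shift_family U F" and "\<mu> \<in> U"
  shows "cosine_transform (interval_measure (F \<mu>)) (Fhat_modulus F 0) \<mu>"
proof -
  have "0 \<in> U" and nz: "\<And>t. Fhat F 0 t \<noteq> 0"
    and real: "\<And>t. Fhat F 0 t = complex_of_real (Fhat_modulus F 0 t)"
    using assms(1) by (auto simp: type_I_location_shift_family_def)
  interpret D: real_distribution "interval_measure (F 0)"
    using type_I_law(1)[OF assms(1) \<open>0 \<in> U\<close>] .
  interpret real_distribution "interval_measure (F \<mu>)"
    using type_I_law(1)[OF assms] .
  show ?thesis
  proof
    show "continuous_on UNIV (Fhat_modulus F 0)"
      unfolding Fhat_modulus_def[abs_def] Fhat_def
      by (intro continuous_on_norm continuous_at_imp_continuous_on ballI D.isCont_char)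
    show "0 < Fhat_modulus F 0 u" for u
      using nz by (simp add: Fhat_modulus_def)
    show "(LINT x|interval_measure (F \<mu>). cos (u * (x - c))) =
        Fhat_modulus F 0 u * cos (u * (\<mu> - c))" for u c
    proof -
      have int: "integrable (interval_measure (F \<mu>)) (\<lambda>x. iexp (u * (x - c)))"
        by (intro integrable_iexp) auto
      have "(LINT x|interval_measure (F \<mu>). cos (u * (x - c))) =
          (LINT x|interval_measure (F \<mu>). Re (iexp (u * (x - c))))"
        by (simp add: Re_exp)
      also have "\<dots> = Re (CLINT x|interval_measure (F \<mu>). iexp (u * (x - c)))"
        by (rule integral_Re[OF int])
      also have "(CLINT x|interval_measure (F \<mu>). iexp (u * (x - c))) =
          (CLINT x|interval_measure (F \<mu>). iexp (- u * c) * iexp (u * x))"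
        by (simp add: exp_add[symmetric] algebra_simps)
      also have "\<dots> = iexp (- u * c) * Fhat F \<mu> u"
        by (simp add: Fhat_def char_def)
      also have "\<dots> = iexp (u * (\<mu> - c)) * complex_of_real (Fhat_modulus F 0 u)"
        unfolding type_I_Fhat[OF assms] real[symmetric]
        by (simp add: exp_add[symmetric] algebra_simps)
      finally show ?thesis
        by (simp add: Re_exp mult_ac)
    qed
  qed
qed

lemma type_I_K10:
  assumes "type_I_location_shift_family U F" and "c \<in> U"
  shows "K10 \<omega> F c t x = deconvolution_kernel \<omega> (Fhat_modulus F 0) t (x - c)"
  by (simp add: K10_def deconvolution_kernel_def type_I_modulus[OF assms])

lemma type_I_psi10:
  assumes "type_I_location_shift_family U F" and "c \<in> U" and "\<mu> \<in> U"
    and \<omega>: "set_integrable lborel {-1..1} \<omega>"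
  shows "integrable (interval_measure (F \<mu>)) (K10 \<omega> F c t)"
    and "psi10 \<omega> F c t \<mu> = (LBINT s:{-1..1}. \<omega> s * cos (t * s * (\<mu> - c)))"
proof -
  interpret cosine_transform "interval_measure (F \<mu>)" "Fhat_modulus F 0" \<mu>
    using type_I_cosine_transform[OF assms(1,3)] .
  show "integrable (interval_measure (F \<mu>)) (K10 \<omega> F c t)"
    using integral_kernel(1)[OF \<omega>] by (simp add: type_I_K10[OF assms(1,2), abs_def])
  show "psi10 \<omega> F c t \<mu> = (LBINT s:{-1..1}. \<omega> s * cos (t * s * (\<mu> - c)))"
    using integral_kernel(2)[OF \<omega>] by (simp add: psi10_def type_I_K10[OF assms(1,2)])
qed

lemma type_I_psi10_tendsto:
  assumes "type_I_location_shift_family U F" and "c \<in> U" and "\<mu> \<in> U"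
    and "admissible_weight \<omega>"
  shows "((\<lambda>t. psi10 \<omega> F c t \<mu>) \<longlongrightarrow> (if \<mu> = c then 1 else 0)) at_top"
proof -
  have \<omega>: "set_integrable lborel {-1..1} \<omega>" "(LBINT s:{-1..1}. \<omega> s) = 1"
    using assms(4) by (auto simp: admissible_weight_def)
  show ?thesis
    using set_Riemann_Lebesgue_cos[OF \<omega>(1), of "\<mu> - c"] \<omega>(2)
    by (auto simp: type_I_psi10(2)[OF assms(1-3) \<omega>(1)])
qed

lemma type_I_psi1:
  assumes "type_I_location_shift_family U F" and "\<mu> \<in> U" and "a \<le> b"
  shows "integrable (interval_measure (F \<mu>)) (K1 F a b t)"
    and "psi1 F a b t \<mu> = 1 / pi * (Si ((\<mu> - a) * t) - Si ((\<mu> - b) * t))"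
proof -
  interpret cosine_transform "interval_measure (F \<mu>)" "Fhat_modulus F 0" \<mu>
    using type_I_cosine_transform[OF assms(1,2)] .
  have one: "set_integrable lborel {-1..1::real} (\<lambda>s. 1::real)"
    by (simp add: set_integrable_def emeasure_lborel_Icc_eq)
  have K1_eq: "K1 F a b t = (\<lambda>x. t / (2 * pi) *
      (LBINT y:{a..b}. deconvolution_kernel (\<lambda>s. 1) (Fhat_modulus F 0) t (x - y)))"
    using \<open>a \<le> b\<close> by (simp add: K1_def fun_eq_iff deconvolution_kernel_def interval_integral_Icc)
  show "integrable (interval_measure (F \<mu>)) (K1 F a b t)"
    unfolding K1_eq by (intro integrable_mult_right integral_kernel_interval one)
  have "psi1 F a b t \<mu> =
      1 / pi * (t / 2 * (LBINT y:{a..b}. (LBINT s:{-1..1}. cos (t * s * (\<mu> - y)))))"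
    by (simp add: psi1_def K1_eq integral_kernel_interval(2)[OF one])
  then show "psi1 F a b t \<mu> = 1 / pi * (Si ((\<mu> - a) * t) - Si ((\<mu> - b) * t))"
    unfolding LBINT_interval_cos_eq_Si_diff[OF \<open>a \<le> b\<close>] by simp
qed

theorem theorem2:
  fixes U :: "real set" and F :: "real \<Rightarrow> real \<Rightarrow> real"
    and \<omega> :: "real \<Rightarrow> real" and a b :: real
  assumes "type_I_location_shift_family U F"
    and "admissible_weight \<omega>"
    and "a \<in> U" and "b \<in> U" and "a < b"
  shows "(\<forall>\<mu>\<in>U. \<forall>t. integrable (interval_measure (F \<mu>)) (K1 F a b t) \<and>
            psi1 F a b t \<mu> = 1 / pi * (LBINT y=(\<mu> - b) * t..(\<mu> - a) * t. sin y / y)) \<and>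
         discriminant_matching_pair U F ({a<..<b} \<inter> U)
           (\<lambda>t \<mu>. psi1 F a b t \<mu> - 1 / 2 * (psi10 \<omega> F a t \<mu> + psi10 \<omega> F b t \<mu>))
           (\<lambda>t x. K1 F a b t x - 1 / 2 * (K10 \<omega> F a t x + K10 \<omega> F b t x))"
proof -
  have \<omega>: "set_integrable lborel {-1..1} \<omega>"
    using assms(2) by (simp add: admissible_weight_def)
  note psi1 = type_I_psi1[OF assms(1) _ less_imp_le[OF \<open>a < b\<close>]]
  note int_a = type_I_psi10(1)[OF assms(1,3) _ \<omega>] and int_b = type_I_psi10(1)[OF assms(1,4) _ \<omega>]
  have limit: "((\<lambda>t. psi1 F a b t \<mu> - 1 / 2 * (psi10 \<omega> F a t \<mu> + psi10 \<omega> F b t \<mu>))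
      \<longlongrightarrow> indicator ({a<..<b} \<inter> U) \<mu>) at_top" if "\<mu> \<in> U" for \<mu>
  proof -
    \<comment> \<open>As \<open>sgn 0 = 0\<close>, this one formula also covers the endpoints, where \<open>Si\<close> is evaluated at \<open>0\<close>.\<close>
    have "((\<lambda>t. psi1 F a b t \<mu> - 1 / 2 * (psi10 \<omega> F a t \<mu> + psi10 \<omega> F b t \<mu>)) \<longlongrightarrow>
        1 / pi * (sgn (\<mu> - a) * (pi / 2) - sgn (\<mu> - b) * (pi / 2)) -
        1 / 2 * ((if \<mu> = a then 1 else 0) + (if \<mu> = b then 1 else 0))) at_top"
      unfolding psi1(2)[OF that]
      by (intro tendsto_diff tendsto_mult_left tendsto_add tendsto_Si_scaled
          type_I_psi10_tendsto[OF assms(1,3) that assms(2)]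
          type_I_psi10_tendsto[OF assms(1,4) that assms(2)])
    also have "1 / pi * (sgn (\<mu> - a) * (pi / 2) - sgn (\<mu> - b) * (pi / 2)) -
        1 / 2 * ((if \<mu> = a then 1 else 0) + (if \<mu> = b then 1 else 0)) =
        indicat_real ({a<..<b} \<inter> U) \<mu>"
      using that \<open>a < b\<close> by (auto simp: sgn_if indicator_def field_simps)
    finally show ?thesis .
  qed
  show ?thesis
    unfolding discriminant_matching_pair_def
  proof (intro conjI ballI allI limit)
    fix \<mu> t assume \<mu>: "\<mu> \<in> U"
    show "integrable (interval_measure (F \<mu>)) (K1 F a b t)"
      by (rule psi1(1)[OF \<mu>])
    show "psi1 F a b t \<mu> = 1 / pi * (LBINT y=(\<mu> - b) * t..(\<mu> - a) * t. sin y / y)"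
      by (simp only: psi1(2)[OF \<mu>] LBINT_sinc_eq_Si_diff)
    show "integrable (interval_measure (F \<mu>))
        (\<lambda>x. K1 F a b t x - 1 / 2 * (K10 \<omega> F a t x + K10 \<omega> F b t x))"
      using psi1(1)[OF \<mu>] int_a[OF \<mu>] int_b[OF \<mu>] by simp
    show "psi1 F a b t \<mu> - 1 / 2 * (psi10 \<omega> F a t \<mu> + psi10 \<omega> F b t \<mu>) =
        (LINT x|interval_measure (F \<mu>). K1 F a b t x - 1 / 2 * (K10 \<omega> F a t x + K10 \<omega> F b t x))"
      using psi1(1)[OF \<mu>] int_a[OF \<mu>] int_b[OF \<mu>] by (simp add: psi1_def psi10_def)
  qed
qed

end
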